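(* Suppose the boundary data of the generalized spinfoam vertex amplitude $A_v(j_f,\xi_{\alpha f})$ satisfy the parallel restriction: for every pair $\Delta=(\alpha,\beta)$ there are unit vectors $\xi_{\alpha\Delta},\xi_{\beta\Delta}\in\mathbb C^2$ and real numbers $\varphi_{\alpha f},\varphi_{\beta f}$ such that $\xi_{\alpha f}=\xi_{\alpha\Delta}e^{i\varphi_{\alpha f}}$ and $\xi_{\beta f}=\xi_{\beta\Delta}e^{i\varphi_{\beta f}}$ for all $f\in\Delta$. Then, up to an overall phase, $A_v$ is equal to the 4-simplex EPRL-FK vertex amplitude with spins $J_\Delta=\sum_{f\in\Delta}j_f$ and boundary data $\xi_{\alpha\Delta}$: $$A_v(j_f,\xi_{\alpha f})=\prod_{\Delta=(\alpha,\beta)}\prod_{f\in\Delta}e^{2ij_f(\varphi_{\beta f}-\varphi_{\alpha f})}\int\prod_{\alpha=1}^5 dg^+_\alpha\,dg^-_\alpha\ \prod_{\pm}\prod_{\Delta=(\alpha,\beta)}\langle\xi_{\alpha\Delta}|(g^\pm_\alpha)^{-1}g^\pm_\beta|\xi_{\beta\Delta}\rangle^{2J^\pm_\Delta},\qquad J_\Delta^\pm=\sum_{f\in\Delta}j_f^\pm .$$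
   Context: Let $\alpha,\beta\in\{1,\dots,5\}$ label five nodes (polyhedra). For each of the ten pairs $\alpha<\beta$ write $\Delta=(\alpha,\beta)$, and let there be a finite nonempty set of links (facets) $f\in\Delta$ joining $\alpha$ and $\beta$, each carrying a spin $j_f\in\frac12\mathbb Z_{>0}$ and unit vectors $\xi_{\alpha f},\xi_{\beta f}\in\mathbb C^2$ (standard Hermitian inner product). Fix $0<\gamma<1$ such that $j_f^\pm=\frac{1\pm\gamma}{2}j_f$ are half-integers (elements of $\frac12\mathbb Z_{\ge0}$). For a spin $j$ and a unit vector $\xi=(\xi^1,\xi^2)^T$, the $SU(2)$ coherent state in the spin-$j$ irrep is $|j,\xi\rangle=g(\xi)|j,j\rangle$, where $|j,j\rangle$ is the highest weight vector and $g(\xi)=\begin{pmatrix}\xi^1&-\bar\xi^2\\ \xi^2&\bar\xi^1\end{pmatrix}$; equivalently $|j,\xi\rangle=|\xi\rangle^{\otimes 2j}$. The (Euclidean) generalized spinfoam vertex amplitude is $$A_v(j_f,\xi_{\alpha f})=\int\prod_{\alpha=1}^5dg^+_\alpha\,dg^-_\alpha\ \prod_\pm\prod_{\alpha<\beta}\prod_{f\in(\alpha,\beta)}\langle j_f^\pm,\xi_{\alpha f}|(g_\alpha^\pm)^{-1}g_\beta^\pm|j_f^\pm,\xi_{\beta f}\rangle ,$$ where each $(g^+_\alpha,g^-_\alpha)$ is integrated over $\mathrm{Spin}(4)=SU(2)\times SU(2)$ with Haar measure. The EPRL-FK 4-simplex amplitude is the same expression with exactly one link for each of the ten pairs $\Delta=(\alpha,\beta)$,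 carrying spin $J_\Delta$ and vectors $\xi_{\alpha\Delta},\xi_{\beta\Delta}$. *)

theory Defs
  imports "HOL-Probability.Probability"
begin

section \<open>SU(2) and its Haar measure\<close>

definition hermitian_adjoint :: "complex ^ 2 ^ 2 \<Rightarrow> complex ^ 2 ^ 2" where
  "hermitian_adjoint g = (\<chi> a b. cnj (g $ b $ a))"

definition SU2 :: "(complex ^ 2 ^ 2) set" where
  "SU2 = {g. hermitian_adjoint g ** g = mat 1 \<and> det g = 1}"

text \<open>\<open>SU2\<close> is compact, hence unimodular: the left-invariant Borel probability measure is
  unique and also right-invariant. Existence is \<open>haar_SU2_exists\<close> below.\<close>

definition haar_SU2 :: "(complex ^ 2 ^ 2) measure \<Rightarrow> bool" where
  "haar_SU2 \<mu> \<longleftrightarrow>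
     prob_space \<mu> \<and> space \<mu> = SU2 \<and> sets \<mu> = sets (restrict_space borel SU2) \<and>
     (\<forall>h\<in>SU2. distr \<mu> \<mu> (\<lambda>g. h ** g) = \<mu>)"

definition su2_of :: "complex ^ 2 \<Rightarrow> complex ^ 2 ^ 2" where
  "su2_of \<xi> = vector [vector [\<xi> $ 1, - cnj (\<xi> $ 2)], vector [\<xi> $ 2, cnj (\<xi> $ 1)]]"


section \<open>Spin representations and coherent states\<close>

text \<open>The spin-\<open>n/2\<close> irrep is the symmetric subspace of the tensor power
  \<open>(\<complex>\<^sup>2)\<^sup>\<otimes>\<^sup>n\<close>. A tensor is given by its components on the multi-indices
  \<open>{..<n} \<rightarrow>\<^sub>E {1, 2}\<close>; note that \<open>2 = 0\<close> in the index type.\<close>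

type_synonym tensor = "(nat \<Rightarrow> 2) \<Rightarrow> complex"

definition multi_index :: "nat \<Rightarrow> (nat \<Rightarrow> 2) set" where
  "multi_index n = {..<n} \<rightarrow>\<^sub>E UNIV"

definition spin_space :: "nat \<Rightarrow> tensor set" where
  "spin_space n = {T. \<forall>p i. p permutes {..<n} \<longrightarrow> i \<in> multi_index n \<longrightarrow> T (i \<circ> p) = T i}"

definition tensor_inner :: "nat \<Rightarrow> tensor \<Rightarrow> tensor \<Rightarrow> complex" where
  "tensor_inner n S T = (\<Sum>i\<in>multi_index n. cnj (S i) * T i)"

definition spin_rep :: "nat \<Rightarrow> complex ^ 2 ^ 2 \<Rightarrow> tensor \<Rightarrow> tensor" where
  "spin_rep n g T = (\<lambda>i. \<Sum>k\<in>multi_index n. (\<Prod>m<n. g $ i m $ k m) * T k)"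

definition highest_weight :: "nat \<Rightarrow> tensor" where
  "highest_weight n = (\<lambda>i. if \<forall>m<n. i m = 1 then 1 else 0)"

definition twice :: "real \<Rightarrow> nat" where
  "twice j = nat \<lfloor>2 * j\<rfloor>"

definition coherent_state :: "real \<Rightarrow> complex ^ 2 \<Rightarrow> tensor" where
  "coherent_state j \<xi> = spin_rep (twice j) (su2_of \<xi>) (highest_weight (twice j))"

definition cinner :: "complex ^ 2 \<Rightarrow> complex ^ 2 \<Rightarrow> complex" where
  "cinner v w = (\<Sum>a\<in>UNIV. cnj (v $ a) * w $ a)"


section \<open>The vertex amplitude\<close>

definition node_pairs :: "(nat \<times> nat) set" where
  "node_pairs = {(\<alpha>, \<beta>). 1 \<le> \<alpha> \<and> \<alpha> < \<beta> \<and> \<beta> \<le> 5}"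

datatype chirality = Plus | Minus

fun chiral_spin :: "real \<Rightarrow> chirality \<Rightarrow> real \<Rightarrow> real" where
  "chiral_spin \<gamma> Plus j = (1 + \<gamma>) / 2 * j"
| "chiral_spin \<gamma> Minus j = (1 - \<gamma>) / 2 * j"

fun chiral_part :: "chirality \<Rightarrow> 'g \<times> 'g \<Rightarrow> 'g" where
  "chiral_part Plus g = fst g"
| "chiral_part Minus g = snd g"

text \<open>The vectors \<open>\<xi>\<^sub>\<alpha>\<^sub>f\<close> are \<open>\<xi> \<alpha> f\<close>; only the values at the two end nodes of a link matter.\<close>

definition boundary_data ::
  "real \<Rightarrow> (nat \<times> nat \<Rightarrow> 'l set) \<Rightarrow> ('l \<Rightarrow> real) \<Rightarrow> (nat \<Rightarrow> 'l \<Rightarrow> complex ^ 2) \<Rightarrow> bool" where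
  "boundary_data \<gamma> links j \<xi> \<longleftrightarrow>
     disjoint_family_on links node_pairs \<and>
     (\<forall>\<alpha> \<beta>. (\<alpha>, \<beta>) \<in> node_pairs \<longrightarrow>
        finite (links (\<alpha>, \<beta>)) \<and> links (\<alpha>, \<beta>) \<noteq> {} \<and>
        (\<forall>f\<in>links (\<alpha>, \<beta>).
           2 * j f \<in> \<nat> \<and> 0 < j f \<and> (\<forall>s. 2 * chiral_spin \<gamma> s (j f) \<in> \<nat>) \<and>
           norm (\<xi> \<alpha> f) = 1 \<and> norm (\<xi> \<beta> f) = 1))"

definition spin4_haar ::
  "(complex ^ 2 ^ 2) measure \<Rightarrow> ((complex ^ 2 ^ 2) \<times> (complex ^ 2 ^ 2)) measure" where
  "spin4_haar \<mu> = \<mu> \<Otimes>\<^sub>M \<mu>"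

definition link_factor ::
  "real \<Rightarrow> complex ^ 2 \<Rightarrow> complex ^ 2 ^ 2 \<Rightarrow> complex ^ 2 ^ 2 \<Rightarrow> complex ^ 2 \<Rightarrow> complex" where
  "link_factor j \<xi> g h \<eta> =
     tensor_inner (twice j) (coherent_state j \<xi>)
       (spin_rep (twice j) (matrix_inv g ** h) (coherent_state j \<eta>))"

definition vertex_amplitude ::
  "(complex ^ 2 ^ 2) measure \<Rightarrow> real \<Rightarrow> (nat \<times> nat \<Rightarrow> 'l set) \<Rightarrow> ('l \<Rightarrow> real) \<Rightarrow>
     (nat \<Rightarrow> 'l \<Rightarrow> complex ^ 2) \<Rightarrow> complex" where
  "vertex_amplitude \<mu> \<gamma> links j \<xi> =
     (LINT g | (\<Pi>\<^sub>M \<alpha>\<in>{1..5::nat}. spin4_haar \<mu>).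
        (\<Prod>s\<in>{Plus, Minus}. \<Prod>(\<alpha>, \<beta>)\<in>node_pairs. \<Prod>f\<in>links (\<alpha>, \<beta>).
           link_factor (chiral_spin \<gamma> s (j f)) (\<xi> \<alpha> f)
             (chiral_part s (g \<alpha>)) (chiral_part s (g \<beta>)) (\<xi> \<beta> f)))"

abbreviation simplex_links :: "nat \<times> nat \<Rightarrow> (nat \<times> nat) set" where
  "simplex_links \<equiv> (\<lambda>\<Delta>. {\<Delta>})"

definition eprl_fk_amplitude ::
  "(complex ^ 2 ^ 2) measure \<Rightarrow> real \<Rightarrow> (nat \<times> nat \<Rightarrow> real) \<Rightarrow>
     (nat \<Rightarrow> nat \<times> nat \<Rightarrow> complex ^ 2) \<Rightarrow> complex" where
  "eprl_fk_amplitude \<mu> \<gamma> J \<xi> = vertex_amplitude \<mu> \<gamma> simplex_links J \<xi>"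

definition parallel_restriction ::
  "(nat \<times> nat \<Rightarrow> 'l set) \<Rightarrow> (nat \<Rightarrow> 'l \<Rightarrow> complex ^ 2) \<Rightarrow>
     (nat \<Rightarrow> nat \<times> nat \<Rightarrow> complex ^ 2) \<Rightarrow> (nat \<Rightarrow> 'l \<Rightarrow> real) \<Rightarrow> bool" where
  "parallel_restriction links \<xi> \<xi>\<Delta> \<phi> \<longleftrightarrow>
     (\<forall>\<alpha> \<beta>. (\<alpha>, \<beta>) \<in> node_pairs \<longrightarrow>
        norm (\<xi>\<Delta> \<alpha> (\<alpha>, \<beta>)) = 1 \<and> norm (\<xi>\<Delta> \<beta> (\<alpha>, \<beta>)) = 1 \<and>
        (\<forall>f\<in>links (\<alpha>, \<beta>).
           \<xi> \<alpha> f = exp (\<i> * \<phi> \<alpha> f) *s \<xi>\<Delta> \<alpha> (\<alpha>, \<beta>) \<and>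
           \<xi> \<beta> f = exp (\<i> * \<phi> \<beta> f) *s \<xi>\<Delta> \<beta> (\<alpha>, \<beta>)))"


section \<open>Consistency of the definitions\<close>

lemma multi_index_permute:
  assumes p: "p permutes {..<n}" and i: "i \<in> multi_index n"
  shows "i \<circ> p \<in> multi_index n"
  using assms unfolding multi_index_def
  by (auto simp: PiE_def extensional_def permutes_not_in)

lemma highest_weight_in_spin_space: "highest_weight n \<in> spin_space n"
proof -
  have "(\<forall>m<n. i (p m) = 1) \<longleftrightarrow> (\<forall>m<n. i m = 1)" if p: "p permutes {..<n}" for p and i :: "nat \<Rightarrow> 2"
    using permutes_image[OF p] by (metis imageE image_eqI lessThan_iff)
  then show ?thesis by (simp add: spin_space_def highest_weight_def)
qed

lemma spin_rep_in_spin_space: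
  assumes T: "T \<in> spin_space n"
  shows "spin_rep n g T \<in> spin_space n"
  unfolding spin_space_def
proof (intro CollectI allI impI)
  fix p and i :: "nat \<Rightarrow> 2"
  assume p: "p permutes {..<n}" and i: "i \<in> multi_index n"
  have inv_p: "inv p permutes {..<n}" by (rule permutes_inv[OF p])
  have "spin_rep n g T i = (\<Sum>k\<in>multi_index n. (\<Prod>m<n. g $ i m $ k m) * T k)"
    by (simp add: spin_rep_def)
  also have "\<dots> = (\<Sum>k\<in>multi_index n. (\<Prod>m<n. g $ (i \<circ> p) m $ k m) * T k)"
  proof (rule sum.reindex_bij_witness[where i = "\<lambda>k. k \<circ> inv p" and j = "\<lambda>k. k \<circ> p"])
    fix k assume k: "k \<in> multi_index n"
    show "k \<circ> p \<circ> inv p = k" by (simp add: o_assoc[symmetric] permutes_inv_o(1)[OF p])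
    show "k \<circ> p \<in> multi_index n" by (rule multi_index_permute[OF p k])
    show "k \<circ> inv p \<circ> p = k" by (simp add: o_assoc[symmetric] permutes_inv_o(2)[OF p])
    show "k \<circ> inv p \<in> multi_index n" by (rule multi_index_permute[OF inv_p k])
    have "(\<Prod>m<n. g $ i (p m) $ k (p m)) = (\<Prod>m<n. g $ i m $ k m)"
      using prod.permute[OF p, of "\<lambda>m. g $ i m $ k m"] by (simp add: o_def)
    then show "(\<Prod>m<n. g $ (i \<circ> p) m $ (k \<circ> p) m) * T (k \<circ> p) = (\<Prod>m<n. g $ i m $ k m) * T k"
      using T p k by (simp add: spin_space_def)
  qed
  finally show "spin_rep n g T (i \<circ> p) = spin_rep n g T i"
    by (simp add: spin_rep_def)
qed

lemma coherent_state_in_spin_space: "coherent_state j \<xi> \<in> spin_space (twice j)"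
  by (simp add: coherent_state_def spin_rep_in_spin_space highest_weight_in_spin_space)


lemma SU2_mult: "g ** h \<in> SU2" if "g \<in> SU2" "h \<in> SU2"
proof -
  have "hermitian_adjoint (g ** h) = hermitian_adjoint h ** hermitian_adjoint g"
    by (simp add: hermitian_adjoint_def matrix_matrix_mult_def vec_eq_iff mult.commute)
  then have "hermitian_adjoint (g ** h) ** (g ** h)
      = hermitian_adjoint h ** (hermitian_adjoint g ** g) ** h"
    by (simp add: matrix_mul_assoc)
  then show ?thesis using that by (simp add: SU2_def det_mul)
qed

lemma det_su2_of: "det (su2_of v) = complex_of_real ((norm v)\<^sup>2)"
proof -
  have "(norm v)\<^sup>2 = (cmod (v $ 1))\<^sup>2 + (cmod (v $ 2))\<^sup>2"
    by (simp add: norm_vec_def L2_set_def sum_2)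
  then show ?thesis
    by (simp add: det_2 su2_of_def complex_norm_square del: of_real_power)
qed

lemma su2_of_in_SU2: "su2_of v \<in> SU2" if "norm v = 1"
proof -
  have *: "v $ 1 * cnj (v $ 1) + v $ 2 * cnj (v $ 2) = 1"
    using det_su2_of[of v] that by (simp add: det_2 su2_of_def mult.commute)
  then have "det (su2_of v) = 1" by (simp add: det_su2_of that)
  moreover have "hermitian_adjoint (su2_of v) ** su2_of v = mat 1"
    using * by (simp add: hermitian_adjoint_def su2_of_def matrix_matrix_mult_def vec_eq_iff
        sum_2 mat_def forall_2 algebra_simps)
  ultimately show ?thesis by (simp add: SU2_def)
qed

lemma SU2_entries:
  assumes "g \<in> SU2"
  shows "g $ 2 $ 2 = cnj (g $ 1 $ 1)" "g $ 1 $ 2 = - cnj (g $ 2 $ 1)"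
proof -
  define a b c d where "a = g $ 1 $ 1" and "b = g $ 1 $ 2" and "c = g $ 2 $ 1" and "d = g $ 2 $ 2"
  note abcd = this
  have 1: "cnj a * a + cnj c * c = 1" and 2: "cnj a * b + cnj c * d = 0" and 3: "a * d - b * c = 1"
    using assms by (simp_all add: SU2_def hermitian_adjoint_def matrix_matrix_mult_def vec_eq_iff
        sum_2 mat_def forall_2 det_2 abcd)
  have "cnj a - d = cnj a * (1 - (a * d - b * c)) + (cnj a * a + cnj c * c - 1) * d
      - c * (cnj a * b + cnj c * d)"
    by (simp add: algebra_simps)
  then have "cnj a = d" using 1 2 3 by simp
  have "cnj c + b = cnj c * (1 - (a * d - b * c)) - (cnj a * a + cnj c * c - 1) * b
      + a * (cnj a * b + cnj c * d)"
    by (simp add: algebra_simps)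
  then have "b = - cnj c" using 1 2 3 by (simp add: add_eq_0_iff)
  show "g $ 2 $ 2 = cnj (g $ 1 $ 1)" "g $ 1 $ 2 = - cnj (g $ 2 $ 1)"
    using \<open>cnj a = d\<close> \<open>b = - cnj c\<close> by (simp_all add: abcd)
qed

lemma su2_of_mult: "su2_of (g *v v) = g ** su2_of v" if "g \<in> SU2"
  using SU2_entries[OF that]
  by (simp add: su2_of_def matrix_matrix_mult_def matrix_vector_mult_def vec_eq_iff sum_2 forall_2
      algebra_simps)

lemma norm_SU2_mult: "norm (g *v v) = norm v" if "g \<in> SU2"
proof -
  have "complex_of_real ((norm (g *v v))\<^sup>2) = det (g ** su2_of v)"
    by (simp add: su2_of_mult[OF that, symmetric] det_su2_of)
  also have "\<dots> = complex_of_real ((norm v)\<^sup>2)"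
    using that by (simp add: det_mul det_su2_of SU2_def)
  finally have "(norm (g *v v))\<^sup>2 = (norm v)\<^sup>2" by (simp only: of_real_eq_iff)
  then show ?thesis by simp
qed

text \<open>The Haar measure is obtained from the uniform distribution on the unit ball of
  \<open>\<real>\<^sup>4 = \<complex>\<^sup>2\<close> by radial projection to the 3-sphere.\<close>

definition complexify :: "real ^ 4 \<Rightarrow> complex ^ 2" where
  "complexify x = vector [Complex (x $ 1) (x $ 2), Complex (x $ 3) (x $ 4)]"

definition realify :: "complex ^ 2 \<Rightarrow> real ^ 4" where
  "realify v = (\<chi> a. if a = 1 then Re (v $ 1) else if a = 2 then Im (v $ 1)
                    else if a = 3 then Re (v $ 2) else Im (v $ 2))"

lemma complexify_realify: "complexify (realify v) = v"
  by (simp add: complexify_def realify_def vec_eq_iff forall_2)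

lemma norm_complexify: "norm (complexify x) = norm x"
  by (simp add: complexify_def norm_vec_def L2_set_def sum_2 sum_4 cmod_power2 add.assoc)

lemma norm_realify: "norm (realify v) = norm v"
  by (metis complexify_realify norm_complexify)

lemma linear_complexify: "linear complexify"
  by (rule linearI) (simp_all add: complexify_def vec_eq_iff forall_2 complex_eq_iff)

lemma linear_realify: "linear realify"
  by (rule linearI) (simp_all add: realify_def vec_eq_iff)

lemma linear_su2_of: "linear su2_of"
  by (rule linearI) (simp_all add: su2_of_def vec_eq_iff forall_2 complex_eq_iff)

lemma distr_uniform_ball_orthogonal:
  fixes T :: "real ^ 4 \<Rightarrow> real ^ 4"
  assumes T: "orthogonal_transformation T"
  defines "N \<equiv> uniform_measure lborel (ball 0 1)"
  shows "distr N borel T = N"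
proof (rule measure_eqI)
  show "sets (distr N borel T) = sets N" by (simp add: N_def)
  have T_meas: "T \<in> borel_measurable borel"
    by (intro borel_measurable_continuous_onI linear_continuous_on
        linear_conv_bounded_linear[THEN iffD1] orthogonal_transformation_linear[OF T])
  fix A assume "A \<in> sets (distr N borel T)"
  then have A: "A \<in> sets borel" by simp
  let ?B = "ball 0 1 :: (real ^ 4) set"
  have TA: "T -` A \<in> sets borel"
    using measurable_sets_borel[OF T_meas A] by simp
  have norm_T: "norm (T x) = norm x" for x
    using T by (simp add: orthogonal_transformation)
  have "T ` (?B \<inter> T -` A) = ?B \<inter> A"
  proof (intro equalityI subsetI)
    fix y assume y: "y \<in> ?B \<inter> A"
    obtain x where "y = T x" using orthogonal_transformation_surj[OF T] by (metis surjD)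
    then show "y \<in> T ` (?B \<inter> T -` A)" using y by (auto simp: norm_T)
  qed (auto simp: norm_T)
  moreover have lm: "?B \<inter> T -` A \<in> lmeasurable" "?B \<inter> A \<in> lmeasurable"
    using TA A by (auto intro!: bounded_set_imp_lmeasurable bounded_Int)
  ultimately have "measure lebesgue (?B \<inter> A) = measure lebesgue (?B \<inter> T -` A)"
    using measure_orthogonal_image[OF T lm(1)] by simp
  then have "emeasure lebesgue (?B \<inter> A) = emeasure lebesgue (?B \<inter> T -` A)"
    by (simp only: emeasure_eq_measure2[OF lm(1)] emeasure_eq_measure2[OF lm(2)])
  then have "emeasure lborel (?B \<inter> A) = emeasure lborel (?B \<inter> T -` A)"
    using TA A by simp
  then show "emeasure (distr N borel T) A = emeasure N A"
    using A TA T_meas by (simp add: N_def emeasure_distr)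
qed

lemma haar_SU2_exists: "\<exists>\<mu>. haar_SU2 \<mu>"
proof -
  define N where "N = uniform_measure lborel (ball 0 1 :: (real ^ 4) set)"
  define G :: "real ^ 4 \<Rightarrow> complex ^ 2 ^ 2"
    where "G x = (if x = 0 then mat 1 else su2_of (complexify (x /\<^sub>R norm x)))" for x
  let ?S = "restrict_space borel SU2 :: (complex ^ 2 ^ 2) measure"
  define \<mu> where "\<mu> = distr N ?S G"
  have sets_N: "sets N = sets borel" and space_N: "space N = UNIV" by (simp_all add: N_def)
  have "emeasure lborel (ball 0 1 :: (real ^ 4) set) \<noteq> 0"
    using content_ball_pos[of 1 "0 :: real ^ 4"] by (auto simp: measure_def)
  then interpret N: prob_space N
    unfolding N_def
    by (intro prob_space_uniform_measure) (simp_all, use emeasure_bounded_finite[of "ball 0 1 :: (real ^ 4) set"] in simp)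
  have SU2_id: "mat 1 \<in> SU2"
    by (simp add: SU2_def hermitian_adjoint_def matrix_matrix_mult_def vec_eq_iff mat_def forall_2 sum_2 det_2)
  have G_SU2: "G x \<in> SU2" for x
    by (simp add: G_def SU2_id su2_of_in_SU2 norm_complexify)
  have "(\<lambda>x. su2_of (complexify x)) \<in> borel_measurable borel"
    using linear_compose[OF linear_complexify linear_su2_of]
    by (intro borel_measurable_continuous_onI linear_continuous_on)
      (simp add: linear_conv_bounded_linear o_def)
  then have "(\<lambda>x. su2_of (complexify (x /\<^sub>R norm x))) \<in> borel_measurable borel"
    by (rule measurable_compose[rotated]) measurable
  then have G_borel: "G \<in> borel_measurable borel"
    unfolding G_def by measurable
  then have G_meas: "G \<in> measurable N ?S"
    by (intro measurable_restrict_space2) (auto simp: G_SU2 measurable_cong_sets[OF sets_N refl])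
  have sets_\<mu>: "sets \<mu> = sets ?S" and space_\<mu>: "space \<mu> = SU2"
    by (simp_all add: \<mu>_def space_restrict_space)
  have "distr \<mu> \<mu> (\<lambda>g. h ** g) = \<mu>" if h: "h \<in> SU2" for h
  proof -
    define T where "T x = realify (h *v complexify x)" for x
    have "linear (\<lambda>v. h *v v)"
      by (rule linearI) (simp_all add: matrix_vector_mult_def vec_eq_iff sum_2 algebra_simps)
    then have "linear T"
      using linear_compose[OF linear_compose[OF linear_complexify] linear_realify]
      by (simp add: T_def[abs_def] o_def)
    moreover have norm_T: "norm (T x) = norm x" for x
      by (simp add: T_def norm_realify norm_SU2_mult[OF h] norm_complexify)
    ultimately have T: "orthogonal_transformation T"
      by (simp add: orthogonal_transformation)
    have T_meas: "T \<in> borel_measurable borel"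
      using \<open>linear T\<close>
      by (intro borel_measurable_continuous_onI linear_continuous_on)
        (simp add: linear_conv_bounded_linear)
    have G_T: "G (T x) = h ** G x" if "x \<noteq> 0" for x
    proof -
      have "T x \<noteq> 0" using norm_T[of x] that by (metis norm_eq_zero)
      then have "G (T x) = su2_of (complexify (T (x /\<^sub>R norm x)))"
        by (simp add: G_def norm_T linear_scale[OF \<open>linear T\<close>])
      also have "\<dots> = h ** G x"
        using that by (simp add: T_def complexify_realify su2_of_mult[OF h] G_def)
      finally show ?thesis .
    qed
    have mult_meas: "(\<lambda>g. h ** g) \<in> measurable ?S ?S"
    proof (rule measurable_restrict_space2)
      have "continuous_on SU2 (\<lambda>g. h ** g)"
        unfolding matrix_matrix_mult_def by (intro continuous_intros)
      then show "(\<lambda>g. h ** g) \<in> borel_measurable ?S"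
        by (rule borel_measurable_continuous_on_restrict)
    qed (auto simp: space_restrict_space SU2_mult h)
    have "distr \<mu> \<mu> (\<lambda>g. h ** g) = distr \<mu> ?S (\<lambda>g. h ** g)"
      by (rule distr_cong) (simp_all add: sets_\<mu>)
    also have "\<dots> = distr N ?S (\<lambda>x. h ** G x)"
      unfolding \<mu>_def using distr_distr[OF mult_meas G_meas] by (simp add: o_def)
    also have "\<dots> = distr N ?S (\<lambda>x. G (T x))"
    proof (rule distr_cong_AE)
      have "AE x in lborel. x \<noteq> (0 :: real ^ 4)" by (rule AE_lborel_singleton)
      then have "AE x in N. x \<noteq> 0"
        unfolding N_def by (intro AE_uniform_measureI) auto
      then show "AE x in N. h ** G x = G (T x)" by eventually_elim (simp add: G_T)
      show "(\<lambda>x. h ** G x) \<in> measurable N ?S"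
        by (rule measurable_compose[OF G_meas mult_meas])
      have "T \<in> measurable N N"
        using T_meas by (simp add: measurable_cong_sets[OF sets_N sets_N])
      then show "(\<lambda>x. G (T x)) \<in> measurable N ?S"
        by (rule measurable_compose[OF _ G_meas])
    qed simp_all
    also have "\<dots> = distr (distr N borel T) ?S G"
    proof -
      have "G \<in> measurable borel ?S" "T \<in> measurable N borel"
        using G_meas T_meas by (simp_all add: measurable_cong_sets[OF sets_N refl])
      then show ?thesis by (simp add: distr_distr o_def)
    qed
    also have "\<dots> = \<mu>"
      using distr_uniform_ball_orthogonal[OF T] by (simp add: N_def \<mu>_def)
    finally show ?thesis .
  qed
  moreover have "prob_space \<mu>"
    unfolding \<mu>_def by (rule N.prob_space_distr[OF G_meas])
  ultimately have "haar_SU2 \<mu>"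
    by (simp add: haar_SU2_def sets_\<mu> space_\<mu>)
  then show ?thesis ..
qed

end

theory Submission
  imports Defs
begin

text \<open>Every coherent state is a tensor power, so its matrix elements are powers of spin-1/2 ones.
  On a bundle of parallel links the powers of one spin-1/2 matrix element multiply and the spins
  add up, while the phases at each link combine over the two chiralities to
  \<open>2 j\<^sup>+ + 2 j\<^sup>- = 2 j\<close>.\<close>

text \<open>Only the entries \<open>i m\<close> with \<open>m < n\<close> matter here, as in
  \<open>highest_weight\<close> and in the output of \<open>spin_rep\<close>. The identities below
  therefore hold as equalities of functions on all \<open>i\<close>, not only on
  \<open>multi_index n\<close>.\<close>

definition tensor_power :: "nat \<Rightarrow> complex ^ 2 \<Rightarrow> tensor" where
  "tensor_power n v = (\<lambda>i. \<Prod>m<n. v $ i m)"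

lemma finite_multi_index: "finite (multi_index n)"
  by (simp add: multi_index_def finite_PiE)

text \<open>Distributivity. It splits a sum over multi-indices into independent sums, one per tensor
  slot, which is how both the group action and the inner product factorize.\<close>

lemma prod_sum_multi_index:
  fixes F :: "nat \<Rightarrow> 2 \<Rightarrow> complex"
  shows "(\<Sum>k\<in>multi_index n. \<Prod>m<n. F m (k m)) = (\<Prod>m<n. \<Sum>a\<in>UNIV. F m a)"
  by (simp add: multi_index_def prod_sum_PiE)

text \<open>The highest weight tensor is the n-th power of the first basis vector, which
  \<open>g\<close> sends to its first column.\<close>

lemma spin_rep_highest_weight:
  "spin_rep n g (highest_weight n) = tensor_power n (\<chi> a. g $ a $ 1)"
proof
  fix i
  \<comment> \<open>The single multi-index at which the highest weight tensor is nonzero. Outside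
    \<open>{..<n}\<close> it must be \<open>undefined\<close> to lie in the extensional function
    space.\<close>
  define ones :: "nat \<Rightarrow> 2" where "ones = (\<lambda>m\<in>{..<n}. 1)"
  have ones: "ones \<in> multi_index n" "\<And>m. m < n \<Longrightarrow> ones m = 1"
    by (simp_all add: ones_def multi_index_def)
  have "(\<forall>m<n. k m = 1) \<longleftrightarrow> k = ones" if "k \<in> multi_index n" for k
    using that by (auto simp: ones_def multi_index_def PiE_def extensional_def fun_eq_iff)
  then have "spin_rep n g (highest_weight n) i
      = (\<Sum>k\<in>multi_index n. if k = ones then \<Prod>m<n. g $ i m $ k m else 0)"
    unfolding spin_rep_def by (intro sum.cong) (simp_all add: highest_weight_def)
  then show "spin_rep n g (highest_weight n) i = tensor_power n (\<chi> a. g $ a $ 1) i"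
    by (simp add: finite_multi_index tensor_power_def ones)
qed

text \<open>The first column of \<open>su2_of \<xi>\<close> is \<open>\<xi>\<close> itself.\<close>

lemma coherent_state_eq_tensor_power: "coherent_state j \<xi> = tensor_power (twice j) \<xi>"
proof -
  have "(\<chi> a. su2_of \<xi> $ a $ 1) = \<xi>"
    by (simp add: su2_of_def vec_eq_iff forall_2)
  then show ?thesis by (simp add: coherent_state_def spin_rep_highest_weight)
qed

lemma spin_rep_tensor_power: "spin_rep n g (tensor_power n v) = tensor_power n (g *v v)"
proof
  show "spin_rep n g (tensor_power n v) i = tensor_power n (g *v v) i" for i
    using prod_sum_multi_index[of "\<lambda>m a. g $ i m $ a * v $ a" n]
    by (simp add: spin_rep_def tensor_power_def prod.distrib matrix_vector_mult_def)
qed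

lemma tensor_inner_tensor_power:
  "tensor_inner n (tensor_power n v) (tensor_power n w) = cinner v w ^ n"
  using prod_sum_multi_index[of "\<lambda>m a. cnj (v $ a) * w $ a" n]
  by (simp add: tensor_inner_def tensor_power_def prod.distrib cinner_def)

lemma link_factor_eq_power:
  "link_factor j \<xi> g h \<eta> = cinner \<xi> (matrix_inv g ** h *v \<eta>) ^ twice j"
  by (simp add: link_factor_def coherent_state_eq_tensor_power spin_rep_tensor_power
      tensor_inner_tensor_power)

lemma cinner_scale: "cinner (p *s v) (q *s w) = cnj p * q * cinner v w"
  by (simp add: cinner_def sum_distrib_left mult_ac)

text \<open>The product is antilinear in its first slot, so the phase at the source node enters
  conjugated. This gives the sign in \<phi>_\<beta> - \<phi>_\<alpha>.\<close>

lemma cinner_phases: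
  fixes a b :: real
  shows "cinner (exp (\<i> * a) *s v) (A *v (exp (\<i> * b) *s w))
    = exp (\<i> * (b - a)) * cinner v (A *v w)"
proof -
  have "cnj (exp (\<i> * a)) * exp (\<i> * b) = exp (\<i> * (b - a))"
    by (simp add: exp_cnj exp_add[symmetric] algebra_simps)
  then show ?thesis by (simp only: vector_scalar_commute cinner_scale)
qed

text \<open>\<open>twice\<close> rounds down and truncates at 0; on half-integer spins neither
  changes the value.\<close>

lemma of_nat_twice: "2 * x \<in> \<nat> \<Longrightarrow> real (twice x) = 2 * x"
  by (auto simp: twice_def elim: Nats_cases)

lemma twice_sum:
  assumes "\<And>f. f \<in> A \<Longrightarrow> 2 * x f \<in> \<nat>"
  shows "twice (\<Sum>f\<in>A. x f) = (\<Sum>f\<in>A. twice (x f))"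
proof -
  have "2 * (\<Sum>f\<in>A. x f) = real (\<Sum>f\<in>A. twice (x f))"
    using assms by (simp add: sum_distrib_left of_nat_twice)
  \<comment> \<open>Unfolding \<open>twice\<close> at the total only keeps the summands natural
    numbers, so the floor is taken of an embedded natural.\<close>
  then show ?thesis
    unfolding twice_def[of "sum x A"] by (simp only: floor_of_nat nat_int)
qed

text \<open>Linearity in the spin: the chiral parts of the total spin are the sums of the chiral
  parts. This matches the exponents of the EPRL-FK amplitude with those of the explicit
  integral.\<close>

lemma chiral_spin_sum: "chiral_spin \<gamma> s (\<Sum>f\<in>A. x f) = (\<Sum>f\<in>A. chiral_spin \<gamma> s (x f))"
  by (cases s) (simp_all add: sum_distrib_left)

lemma exp_power_chiral_spins:
  fixes t :: real
  assumes "\<And>s. 2 * chiral_spin \<gamma> s x \<in> \<nat>"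
  shows "(\<Prod>s\<in>{Plus, Minus}. exp (\<i> * t) ^ twice (chiral_spin \<gamma> s x)) = exp (2 * \<i> * x * t)"
proof -
  \<comment> \<open>The contributions of \<open>\<gamma>\<close> cancel: (1 + \<gamma>)/2 + (1 -
    \<gamma>)/2 = 1.\<close>
  have "real (twice (chiral_spin \<gamma> Plus x) + twice (chiral_spin \<gamma> Minus x)) = 2 * x"
    using of_nat_twice[OF assms[of Plus]] of_nat_twice[OF assms[of Minus]]
    by (simp add: field_simps)
  then have *: "complex_of_nat (twice (chiral_spin \<gamma> Plus x) + twice (chiral_spin \<gamma> Minus x)) = 2 * x"
    by (metis of_real_of_nat_eq)
  have "(\<Prod>s\<in>{Plus, Minus}. exp (\<i> * t) ^ twice (chiral_spin \<gamma> s x))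
      = exp (\<i> * t) ^ (twice (chiral_spin \<gamma> Plus x) + twice (chiral_spin \<gamma> Minus x))"
    by (simp add: power_add)
  also have "\<dots> = exp (2 * \<i> * x * t)"
    unfolding exp_of_nat_mult[symmetric] * by (simp add: mult_ac)
  finally show ?thesis .
qed

lemma Nats_sum: "(\<And>x. x \<in> A \<Longrightarrow> f x \<in> \<nat>) \<Longrightarrow> sum f A \<in> \<nat>"
  by (induction A rule: infinite_finite_induct) auto

text \<open>Ensures that the reduced amplitude is evaluated on admissible data. Positivity of the
  total spins uses that each link set is finite and nonempty; integrality follows from closure of
  the naturals under sums.\<close>

lemma boundary_data_simplex:
  assumes bd: "boundary_data \<gamma> links j \<xi>" and par: "parallel_restriction links \<xi> \<xi>\<Delta> \<phi>"
  shows "boundary_data \<gamma> simplex_links (\<lambda>\<Delta>. \<Sum>f\<in>links \<Delta>. j f) \<xi>\<Delta>"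
proof -
  have "2 * (\<Sum>f\<in>links \<Delta>. j f) \<in> \<nat>" "0 < (\<Sum>f\<in>links \<Delta>. j f)"
    "2 * chiral_spin \<gamma> s (\<Sum>f\<in>links \<Delta>. j f) \<in> \<nat>" if "\<Delta> \<in> node_pairs" for \<Delta> s
    using bd that unfolding boundary_data_def
    by (cases \<Delta>; auto simp: sum_distrib_left chiral_spin_sum intro!: sum_pos Nats_sum)+
  then show ?thesis
    using par by (auto simp: boundary_data_def parallel_restriction_def disjoint_family_on_def)
qed

text \<open>The identity holds pointwise in \<open>g\<close>, and the phase product on the right
  does not involve \<open>g\<close>, so it can later leave the integral.\<close>

lemma integrand_parallel:
  assumes bd: "boundary_data \<gamma> links j \<xi>" and par: "parallel_restriction links \<xi> \<xi>\<Delta> \<phi>"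
  shows "(\<Prod>s\<in>{Plus, Minus}. \<Prod>(\<alpha>, \<beta>)\<in>node_pairs. \<Prod>f\<in>links (\<alpha>, \<beta>).
      link_factor (chiral_spin \<gamma> s (j f)) (\<xi> \<alpha> f)
        (chiral_part s (g \<alpha>)) (chiral_part s (g \<beta>)) (\<xi> \<beta> f))
    = (\<Prod>(\<alpha>, \<beta>)\<in>node_pairs. \<Prod>f\<in>links (\<alpha>, \<beta>). exp (2 * \<i> * j f * (\<phi> \<beta> f - \<phi> \<alpha> f))) *
      (\<Prod>s\<in>{Plus, Minus}. \<Prod>(\<alpha>, \<beta>)\<in>node_pairs.
        cinner (\<xi>\<Delta> \<alpha> (\<alpha>, \<beta>))
          (matrix_inv (chiral_part s (g \<alpha>)) ** chiral_part s (g \<beta>) *v \<xi>\<Delta> \<beta> (\<alpha>, \<beta>))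
        ^ twice (\<Sum>f\<in>links (\<alpha>, \<beta>). chiral_spin \<gamma> s (j f)))"
    (is "?L = ?P * ?R")
proof -
  let ?S = "{Plus, Minus}"
  \<comment> \<open>Each link factor splits into \<open>e\<close>, which is independent of chirality
    and group elements, and \<open>c\<close>, which is the same for all links of a pair; both are
    raised to the power \<open>n\<close>.\<close>
  define n where "n s f = twice (chiral_spin \<gamma> s (j f))" for s f
  define e :: "nat \<Rightarrow> nat \<Rightarrow> 'a \<Rightarrow> complex" where "e \<alpha> \<beta> f = exp (\<i> * (\<phi> \<beta> f - \<phi> \<alpha> f))" for \<alpha> \<beta> f
  define c where "c s \<alpha> \<beta> = cinner (\<xi>\<Delta> \<alpha> (\<alpha>, \<beta>))
    (matrix_inv (chiral_part s (g \<alpha>)) ** chiral_part s (g \<beta>) *v \<xi>\<Delta> \<beta> (\<alpha>, \<beta>))" for s \<alpha> \<beta>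
  have nat: "2 * chiral_spin \<gamma> s (j f) \<in> \<nat>"
    if "(\<alpha>, \<beta>) \<in> node_pairs" "f \<in> links (\<alpha>, \<beta>)" for s f \<alpha> \<beta>
    using bd that by (auto simp: boundary_data_def)
  have "link_factor (chiral_spin \<gamma> s (j f)) (\<xi> \<alpha> f)
      (chiral_part s (g \<alpha>)) (chiral_part s (g \<beta>)) (\<xi> \<beta> f) = e \<alpha> \<beta> f ^ n s f * c s \<alpha> \<beta> ^ n s f"
    if "(\<alpha>, \<beta>) \<in> node_pairs" "f \<in> links (\<alpha>, \<beta>)" for s f \<alpha> \<beta>
  proof -
    have "\<xi> \<alpha> f = exp (\<i> * \<phi> \<alpha> f) *s \<xi>\<Delta> \<alpha> (\<alpha>, \<beta>)" "\<xi> \<beta> f = exp (\<i> * \<phi> \<beta> f) *s \<xi>\<Delta> \<beta> (\<alpha>, \<beta>)"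
      using par that by (simp_all add: parallel_restriction_def)
    then show ?thesis
      by (simp add: link_factor_eq_power cinner_phases n_def e_def c_def power_mult_distrib)
  qed
  then have "?L = (\<Prod>s\<in>?S. \<Prod>(\<alpha>, \<beta>)\<in>node_pairs. \<Prod>f\<in>links (\<alpha>, \<beta>).
      e \<alpha> \<beta> f ^ n s f * c s \<alpha> \<beta> ^ n s f)"
    by (intro prod.cong refl) (auto intro!: prod.cong)
  also have "\<dots> = (\<Prod>s\<in>?S. \<Prod>(\<alpha>, \<beta>)\<in>node_pairs. \<Prod>f\<in>links (\<alpha>, \<beta>). e \<alpha> \<beta> f ^ n s f) *
      (\<Prod>s\<in>?S. \<Prod>(\<alpha>, \<beta>)\<in>node_pairs. \<Prod>f\<in>links (\<alpha>, \<beta>). c s \<alpha> \<beta> ^ n s f)"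
    by (simp only: prod.distrib case_prod_unfold)
  \<comment> \<open>The chirality product moves inside, first past the pairs and then past the
    links, so that the two exponents of each link phase can be added.\<close>
  also have "(\<Prod>s\<in>?S. \<Prod>(\<alpha>, \<beta>)\<in>node_pairs. \<Prod>f\<in>links (\<alpha>, \<beta>). e \<alpha> \<beta> f ^ n s f)
      = (\<Prod>(\<alpha>, \<beta>)\<in>node_pairs. \<Prod>f\<in>links (\<alpha>, \<beta>). \<Prod>s\<in>?S. e \<alpha> \<beta> f ^ n s f)"
    unfolding case_prod_unfold by (subst prod.swap, intro prod.cong refl, rule prod.swap)
  also have "\<dots> = ?P"
  proof -
    have "(\<Prod>s\<in>?S. e \<alpha> \<beta> f ^ n s f) = exp (2 * \<i> * j f * (\<phi> \<beta> f - \<phi> \<alpha> f))"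
      if "(\<alpha>, \<beta>) \<in> node_pairs" "f \<in> links (\<alpha>, \<beta>)" for \<alpha> \<beta> f
      using exp_power_chiral_spins[OF nat[OF that], of "\<phi> \<beta> f - \<phi> \<alpha> f"]
      by (simp add: n_def e_def del: prod.insert)
    then show ?thesis
      by (intro prod.cong refl) (auto simp del: prod.insert intro!: prod.cong)
  qed
  \<comment> \<open>The base does not depend on the link, so the exponents add up, and
    \<open>twice\<close> commutes with the sum because every chiral spin is a half-integer.\<close>
  also have "(\<Prod>s\<in>?S. \<Prod>(\<alpha>, \<beta>)\<in>node_pairs. \<Prod>f\<in>links (\<alpha>, \<beta>). c s \<alpha> \<beta> ^ n s f) = ?R"
  proof -
    have "(\<Prod>f\<in>links (\<alpha>, \<beta>). c s \<alpha> \<beta> ^ n s f)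
        = c s \<alpha> \<beta> ^ twice (\<Sum>f\<in>links (\<alpha>, \<beta>). chiral_spin \<gamma> s (j f))"
      if "(\<alpha>, \<beta>) \<in> node_pairs" for s \<alpha> \<beta>
      using twice_sum[of "links (\<alpha>, \<beta>)" "\<lambda>f. chiral_spin \<gamma> s (j f)"] nat[OF that]
      by (simp add: n_def power_sum del: chiral_spin.simps)
    then show ?thesis
      unfolding c_def by (intro prod.cong refl) auto
  qed
  finally show ?thesis .
qed

theorem mainTheorem3:
  fixes \<mu> :: "(complex ^ 2 ^ 2) measure"
    and \<gamma> :: real
    and links :: "nat \<times> nat \<Rightarrow> 'l set"
    and j :: "'l \<Rightarrow> real"
    and \<xi> :: "nat \<Rightarrow> 'l \<Rightarrow> complex ^ 2"
    and \<xi>\<Delta> :: "nat \<Rightarrow> nat \<times> nat \<Rightarrow> complex ^ 2"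
    and \<phi> :: "nat \<Rightarrow> 'l \<Rightarrow> real"
  assumes "haar_SU2 \<mu>"
    and "0 < \<gamma>" and "\<gamma> < 1"
    and "boundary_data \<gamma> links j \<xi>"
    and "parallel_restriction links \<xi> \<xi>\<Delta> \<phi>"
  shows "let J = (\<lambda>\<Delta>. \<Sum>f\<in>links \<Delta>. j f);
             J\<^sub>s = (\<lambda>s \<Delta>. \<Sum>f\<in>links \<Delta>. chiral_spin \<gamma> s (j f));
             phase = (\<Prod>(\<alpha>, \<beta>)\<in>node_pairs. \<Prod>f\<in>links (\<alpha>, \<beta>).
                        exp (2 * \<i> * j f * (\<phi> \<beta> f - \<phi> \<alpha> f)))
         in boundary_data \<gamma> simplex_links J \<xi>\<Delta> \<and>
            cmod phase = 1 \<and>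
            vertex_amplitude \<mu> \<gamma> links j \<xi> = phase * eprl_fk_amplitude \<mu> \<gamma> J \<xi>\<Delta> \<and>
            vertex_amplitude \<mu> \<gamma> links j \<xi> = phase *
              (LINT g | (\<Pi>\<^sub>M \<alpha>\<in>{1..5::nat}. spin4_haar \<mu>).
                 (\<Prod>s\<in>{Plus, Minus}. \<Prod>(\<alpha>, \<beta>)\<in>node_pairs.
                    cinner (\<xi>\<Delta> \<alpha> (\<alpha>, \<beta>))
                      (matrix_inv (chiral_part s (g \<alpha>)) ** chiral_part s (g \<beta>) *v \<xi>\<Delta> \<beta> (\<alpha>, \<beta>))
                    ^ twice (J\<^sub>s s (\<alpha>, \<beta>))))"
proof -
  define J where "J \<Delta> = (\<Sum>f\<in>links \<Delta>. j f)" for \<Delta>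
  define phase where "phase = (\<Prod>(\<alpha>, \<beta>)\<in>node_pairs. \<Prod>f\<in>links (\<alpha>, \<beta>).
    exp (2 * \<i> * j f * (\<phi> \<beta> f - \<phi> \<alpha> f)))"
  \<comment> \<open>Both integrals in the conclusion are this one: it is the explicit formula, and
    it is also what the EPRL-FK amplitude unfolds to.\<close>
  define I where "I = (LINT g | (\<Pi>\<^sub>M \<alpha>\<in>{1..5::nat}. spin4_haar \<mu>).
    (\<Prod>s\<in>{Plus, Minus}. \<Prod>(\<alpha>, \<beta>)\<in>node_pairs.
      cinner (\<xi>\<Delta> \<alpha> (\<alpha>, \<beta>))
        (matrix_inv (chiral_part s (g \<alpha>)) ** chiral_part s (g \<beta>) *v \<xi>\<Delta> \<beta> (\<alpha>, \<beta>))
      ^ twice (\<Sum>f\<in>links (\<alpha>, \<beta>). chiral_spin \<gamma> s (j f))))"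
  \<comment> \<open>Evaluates products over one-link sets when \<open>prod.insert\<close> is
    disabled, which keeps the product over chiralities folded.\<close>
  have singleton: "(\<Prod>f\<in>{\<Delta>}. F f) = F \<Delta>" for F :: "nat \<times> nat \<Rightarrow> complex" and \<Delta>
    by simp
  have "boundary_data \<gamma> simplex_links J \<xi>\<Delta>"
    using boundary_data_simplex[OF assms(4,5)] by (simp add: J_def[abs_def])
  \<comment> \<open>Every factor is the exponential of a purely imaginary number.\<close>
  moreover have "cmod phase = 1"
    unfolding phase_def case_prod_unfold prod_norm[symmetric]
    by (intro prod.neutral ballI) simp
  \<comment> \<open>A constant factor leaves the Bochner integral without an integrability goal,
    since non-integrable functions have integral 0 by convention.\<close>
  moreover have "vertex_amplitude \<mu> \<gamma> links j \<xi> = phase * I"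
    unfolding vertex_amplitude_def integrand_parallel[OF assms(4,5)] phase_def I_def
    by (rule integral_mult_right_zero)
  moreover have "eprl_fk_amplitude \<mu> \<gamma> J \<xi>\<Delta> = I"
    by (simp add: eprl_fk_amplitude_def vertex_amplitude_def link_factor_eq_power I_def J_def
        chiral_spin_sum case_prod_unfold singleton del: prod.insert)
  ultimately show ?thesis
    unfolding Let_def phase_def I_def J_def by simp
qed

end
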